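(* Let $(X,p_\theta,\theta)$ be a $0$-complete partial extended $b$-metric space. Let $k\in[0,\tfrac12)$ be a constant and let $T:X\to X$ be a mapping such that $\theta(Tx,x)<\frac1k$ for all $x\in X$ and $$p_\theta(Tx,Ty)\le k\,\big[p_\theta(x,Ty)+p_\theta(y,Ty)\big]\qquad\text{for all }x,y\in X.$$ If there exists an element $x_0\in X$ such that $\lim_{n\to\infty}n\,p_\theta(T^n x_0,T^n x_0)=0$, then $T$ has a unique fixed point $u\in X$. Moreover, $u=\lim_{n\to\infty}T^n x_0$ and $p_\theta(u,u)=0$.
   Context: Let $X$ be a non-empty set and $\theta:X\times X\to[1,\infty)$. A function $p_\theta:X\times X\to[0,\infty)$ is a partial extended $b$-metric on $X$ (and $(X,p_\theta,\theta)$ is a partial extended $b$-metric space) if for all $x,y,z\in X$: (1) $p_\theta(x,x)=p_\theta(x,y)=p_\theta(y,y)$ if and only if $x=y$; (2) $p_\theta(x,x)\le p_\theta(x,y)$; (3) $p_\theta(x,y)=p_\theta(y,x)$; (4) $p_\theta(x,z)\le\theta(x,z)\,[p_\theta(x,y)+p_\theta(y,z)]-p_\theta(y,y)$. A sequence $\{x_n\}$ in $X$ converges to $x\in X$ (written $x=\lim_{n\to\infty}x_n$) if $\lim_{n\to\infty}p_\theta(x_n,x)=p_\theta(x,x)$. A sequence $\{x_n\}$ in $X$ is $0$-Cauchy if $\lim_{n,m\to\infty}p_\theta(x_n,x_m)=0$. The space is $0$-complete if for each $0$-Cauchy sequence $\{x_n\}$ in $X$ there exists $x\in X$ such that $\lim_{n,m\to\infty}p_\theta(x_n,x_m)=\lim_{n\to\infty}p_\theta(x_n,x)=p_\theta(x,x)=0$.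 When $k=0$, $\frac1k$ is read as $+\infty$. *)

theory Defs
  imports Complex_Main "HOL-Library.FuncSet" "HOL-Library.Extended_Real"
begin

locale partial_extended_b_metric_space =
  fixes X :: "'a set"
    and p :: "'a \<Rightarrow> 'a \<Rightarrow> real"
    and \<theta> :: "'a \<Rightarrow> 'a \<Rightarrow> real"
  assumes nonempty: "X \<noteq> {}"
    and theta_ge_1: "\<And>x y. x \<in> X \<Longrightarrow> y \<in> X \<Longrightarrow> 1 \<le> \<theta> x y"
    and p_nonneg: "\<And>x y. x \<in> X \<Longrightarrow> y \<in> X \<Longrightarrow> 0 \<le> p x y"
    and p_eq_iff: "\<And>x y. x \<in> X \<Longrightarrow> y \<in> X \<Longrightarrow> (p x x = p x y \<and> p x y = p y y) \<longleftrightarrow> x = y"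
    and p_self_le: "\<And>x y. x \<in> X \<Longrightarrow> y \<in> X \<Longrightarrow> p x x \<le> p x y"
    and p_sym: "\<And>x y. x \<in> X \<Longrightarrow> y \<in> X \<Longrightarrow> p x y = p y x"
    and p_triangle: "\<And>x y z. x \<in> X \<Longrightarrow> y \<in> X \<Longrightarrow> z \<in> X \<Longrightarrow>
                       p x z \<le> \<theta> x z * (p x y + p y z) - p y y"

text \<open>Limits in this sense need not be unique, so convergence is a relation.\<close>

definition converges_to :: "'a set \<Rightarrow> ('a \<Rightarrow> 'a \<Rightarrow> real) \<Rightarrow> (nat \<Rightarrow> 'a) \<Rightarrow> 'a \<Rightarrow> bool" where
  "converges_to X p s x \<longleftrightarrow>
     range s \<subseteq> X \<and> x \<in> X \<and> (\<lambda>n. p (s n) x) \<longlonglongrightarrow> p x x"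

definition zero_Cauchy :: "'a set \<Rightarrow> ('a \<Rightarrow> 'a \<Rightarrow> real) \<Rightarrow> (nat \<Rightarrow> 'a) \<Rightarrow> bool" where
  "zero_Cauchy X p s \<longleftrightarrow>
     range s \<subseteq> X \<and> ((\<lambda>(n, m). p (s n) (s m)) \<longlongrightarrow> 0) (sequentially \<times>\<^sub>F sequentially)"

definition zero_complete :: "'a set \<Rightarrow> ('a \<Rightarrow> 'a \<Rightarrow> real) \<Rightarrow> bool" where
  "zero_complete X p \<longleftrightarrow>
     (\<forall>s. zero_Cauchy X p s \<longrightarrow>
        (\<exists>x\<in>X. ((\<lambda>(n, m). p (s n) (s m)) \<longlongrightarrow> 0) (sequentially \<times>\<^sub>F sequentially) \<and>
               (\<lambda>n. p (s n) x) \<longlonglongrightarrow> 0 \<and> p x x = 0))"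

text \<open>With \<open>1 / ereal k\<close> the bound \<open>1 / k\<close> is infinite for \<open>k = 0\<close>, unlike real division.\<close>

lemma one_divide_ereal_zero: "1 / ereal 0 = \<infinity>"
  by (simp add: divide_ereal_def)

lemma one_divide_ereal_nonzero: "k \<noteq> 0 \<Longrightarrow> 1 / ereal k = ereal (1 / k)"
  by (simp add: one_ereal_def)

end

theory Submission
  imports Defs
begin

text \<open>
  Write \<open>x\<^sub>n = T\<^sup>n x\<^sub>0\<close>. The contraction condition is not symmetric in \<open>x\<close> and \<open>y\<close>: after
  expanding \<open>p (T x) (T y)\<close>, the image \<open>T y\<close> stays in both terms and only \<open>x\<close> loses an application
  of \<open>T\<close>. Consequently, along the orbit the quantity \<open>p x\<^sub>m x\<^sub>n\<close> satisfies the affine recursion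
  \<open>p x\<^sub>m\<^sub>+\<^sub>1 x\<^sub>n\<^sub>+\<^sub>1 \<le> k * p x\<^sub>m x\<^sub>n\<^sub>+\<^sub>1 + k * p x\<^sub>n x\<^sub>n\<^sub>+\<^sub>1\<close>, in which the second index is merely a
  parameter.

  With \<open>m = n + 1\<close> the first term on the right is a self-distance, and the self-distances of the
  orbit vanish by the assumption on \<open>x\<^sub>0\<close>; hence the step lengths \<open>p x\<^sub>n x\<^sub>n\<^sub>+\<^sub>1\<close> tend to \<open>0\<close>. Iterating
  in \<open>m\<close> from \<open>m = n + 1\<close> upwards bounds \<open>p x\<^sub>m x\<^sub>n\<^sub>+\<^sub>1\<close>, uniformly in \<open>m > n\<close>, by the self-distance of
  \<open>x\<^sub>n\<^sub>+\<^sub>1\<close> plus \<open>k / (1 - k) \<le> 1\<close> times a step length. So the orbit is \<open>0\<close>-Cauchy.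

  For the limit \<open>u\<close>, the contraction condition shows that \<open>p (T u) x\<^sub>n\<close> tends to \<open>0\<close> as well. The
  triangle inequality between \<open>T u\<close> and \<open>u\<close>, in which the factor is the constant
  \<open>\<theta> (T u) u\<close>, then gives \<open>p (T u) u = 0\<close>, that is \<open>T u = u\<close>. For two fixed points \<open>u\<close> and \<open>v\<close>, the
  contraction condition together with \<open>p v v \<le> p u v\<close> yields \<open>p u v \<le> 2 * k * p u v\<close>, which forces
  \<open>p u v = 0\<close> because \<open>2 * k < 1\<close>.
\<close>

section \<open>Affine recursive inequalities\<close>

text \<open>
  The number \<open>c\<close> is chosen as the fixed point of \<open>t \<mapsto> k * t + (1 - k) * c\<close>, so the excess over \<open>c\<close>
  shrinks by the factor \<open>k\<close> in every step.
\<close>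

lemma affine_recursion_bound:
  fixes b :: "nat \<Rightarrow> real"
  assumes "0 \<le> k" "0 \<le> c"
    and step: "\<And>j. b (Suc j) \<le> k * b j + (1 - k) * c"
  shows "b j \<le> k ^ j * b 0 + c"
proof (induction j)
  case 0
  show ?case using \<open>0 \<le> c\<close> by simp
next
  case (Suc j)
  have "b (Suc j) \<le> k * (k ^ j * b 0 + c) + (1 - k) * c"
    using step[of j] mult_left_mono[OF Suc \<open>0 \<le> k\<close>] by linarith
  then show ?case by (simp add: algebra_simps)
qed

text \<open>
  Once \<open>r\<close> stays below \<open>(1 - k) * (e / 2)\<close>, the preceding bound applies to the shifted sequence and
  leaves \<open>e / 2\<close> plus a geometrically decaying term.
\<close>

lemma affine_recursion_tendsto_0:
  fixes d r :: "nat \<Rightarrow> real"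
  assumes "0 \<le> k" "k < 1"
    and nonneg: "\<And>n. 0 \<le> d n"
    and step: "\<And>n. d (Suc n) \<le> k * d n + r n"
    and r: "r \<longlonglongrightarrow> 0"
  shows "d \<longlonglongrightarrow> 0"
proof (rule LIMSEQ_I)
  fix e :: real
  assume "0 < e"
  then have "0 < (1 - k) * (e / 2)" using \<open>k < 1\<close> by simp
  then obtain N where N: "\<And>n. n \<ge> N \<Longrightarrow> norm (r n - 0) < (1 - k) * (e / 2)"
    using LIMSEQ_D[OF r] by blast
  have bound: "d (N + j) \<le> k ^ j * d (N + 0) + e / 2" for j
  proof (rule affine_recursion_bound[where b = "\<lambda>j. d (N + j)"])
    show "d (N + Suc i) \<le> k * d (N + i) + (1 - k) * (e / 2)" for i
      using step[of "N + i"] N[of "N + i"] by simp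
  qed (use \<open>0 \<le> k\<close> \<open>0 < e\<close> in auto)
  have "(\<lambda>j. k ^ j * d N) \<longlonglongrightarrow> 0"
    using LIMSEQ_power_zero[of k] assms(1,2) by (intro tendsto_mult_left_zero) simp
  then obtain J where J: "\<And>j. j \<ge> J \<Longrightarrow> norm (k ^ j * d N - 0) < e / 2"
    using LIMSEQ_D[of _ 0 "e / 2"] \<open>0 < e\<close> by (metis half_gt_zero)
  show "\<exists>M. \<forall>n\<ge>M. norm (d n - 0) < e"
  proof (intro exI allI impI)
    fix n assume n: "n \<ge> N + J"
    then have "d n \<le> k ^ (n - N) * d N + e / 2" using bound[of "n - N"] by simp
    moreover have "norm (k ^ (n - N) * d N - 0) < e / 2" using n by (intro J) simp
    ultimately show "norm (d n - 0) < e" using nonneg[of n] by simp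
  qed
qed

lemma tendsto_0_if_mult_real_of_nat_tendsto_0:
  fixes e :: "nat \<Rightarrow> real"
  assumes "(\<lambda>n. real n * e n) \<longlonglongrightarrow> 0"
  shows "e \<longlonglongrightarrow> 0"
proof (rule tendsto_0_le[OF assms, where K = 1])
  have "norm (e n) \<le> norm (real n * e n) * 1" if "n \<ge> 1" for n
    using that mult_right_mono[of 1 "real n" "\<bar>e n\<bar>"] by (simp add: abs_mult)
  then show "\<forall>\<^sub>F n in sequentially. norm (e n) \<le> norm (real n * e n) * 1"
    using eventually_at_top_linorder by blast
qed

section \<open>Orbits of the contraction\<close>

locale one_sided_contraction = partial_extended_b_metric_space X p \<theta>
  for X :: "'a set" and p \<theta> +
  fixes k :: real and T :: "'a \<Rightarrow> 'a"
  assumes k_nonneg: "0 \<le> k" and k_less_half: "k < 1 / 2"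
    and T_in: "x \<in> X \<Longrightarrow> T x \<in> X"
    and contraction: "x \<in> X \<Longrightarrow> y \<in> X \<Longrightarrow> p (T x) (T y) \<le> k * (p x (T y) + p y (T y))"
begin

lemma zero_distance_imp_eq:
  assumes "x \<in> X" "y \<in> X" "p x y = 0"
  shows "x = y"
  using assms p_self_le[of x y] p_self_le[of y x] p_nonneg[of x x] p_nonneg[of y y]
    p_sym[of x y] p_eq_iff[of x y] by auto

lemma funpow_in: "x \<in> X \<Longrightarrow> (T ^^ n) x \<in> X"
  by (induction n) (auto intro: T_in)

text \<open>
  The order of the arguments matters: taking the later point as \<open>x\<close> in the contraction condition
  turns \<open>p x (T y)\<close> into a self-distance. In the other order, the distance between
  points two steps apart would appear.
\<close>

lemma orbit_steps_tendsto_0: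
  assumes x: "x \<in> X"
    and self: "(\<lambda>n. p ((T ^^ n) x) ((T ^^ n) x)) \<longlonglongrightarrow> 0"
  shows "(\<lambda>n. p ((T ^^ n) x) ((T ^^ Suc n) x)) \<longlonglongrightarrow> 0"
proof (rule affine_recursion_tendsto_0[where k = k])
  let ?e = "\<lambda>n. k * p ((T ^^ Suc n) x) ((T ^^ Suc n) x)"
  show "?e \<longlonglongrightarrow> 0"
    using LIMSEQ_Suc[OF self] by (rule tendsto_mult_right_zero)
  fix n
  have X: "(T ^^ m) x \<in> X" for m using x by (rule funpow_in)
  show "p ((T ^^ Suc n) x) ((T ^^ Suc (Suc n)) x) \<le> k * p ((T ^^ n) x) ((T ^^ Suc n) x) + ?e n"
    using contraction[OF X[of "Suc n"] X[of n]] p_sym[OF X[of "Suc n"] X[of "Suc (Suc n)"]]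
    by (simp add: algebra_simps)
  show "0 \<le> p ((T ^^ n) x) ((T ^^ Suc n) x)" using X by (intro p_nonneg)
qed (use k_nonneg k_less_half in auto)

text \<open>
  Each iteration in \<open>j\<close> contracts the distance by \<open>k\<close> and adds the same error
  \<open>k * p ((T ^^ n) x) ((T ^^ Suc n) x)\<close>. These errors sum to a geometric series with total at most
  \<open>k / (1 - k) \<le> 1\<close> times the step length, which is why the bound is uniform in \<open>j\<close>.
\<close>

lemma orbit_distance_bound:
  assumes x: "x \<in> X"
  shows "p ((T ^^ (Suc n + j)) x) ((T ^^ Suc n) x)
    \<le> p ((T ^^ Suc n) x) ((T ^^ Suc n) x) + p ((T ^^ n) x) ((T ^^ Suc n) x)"
proof -
  let ?y = "(T ^^ Suc n) x"
  let ?s = "p ((T ^^ n) x) ?y"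
  let ?b = "\<lambda>j. p ((T ^^ (Suc n + j)) x) ?y"
  have X: "(T ^^ m) x \<in> X" for m using x by (rule funpow_in)
  have s: "0 \<le> ?s" using X by (intro p_nonneg)
  have step: "?b (Suc i) \<le> k * ?b i + (1 - k) * ?s" for i
  proof -
    have "?b (Suc i) \<le> k * ?b i + k * ?s"
      using contraction[OF X[of "Suc n + i"] X[of n]] by (simp add: algebra_simps)
    moreover have "k * ?s \<le> (1 - k) * ?s"
      using k_less_half s by (intro mult_right_mono) auto
    ultimately show ?thesis by linarith
  qed
  have "?b j \<le> k ^ j * ?b 0 + ?s"
    by (rule affine_recursion_bound[where b = ?b, OF k_nonneg s step])
  also have "k ^ j * ?b 0 \<le> 1 * ?b 0"
    using k_nonneg k_less_half
    by (intro mult_right_mono power_le_one p_nonneg X) auto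
  finally show ?thesis by simp
qed

lemma orbit_zero_Cauchy:
  assumes x: "x \<in> X"
    and self: "(\<lambda>n. p ((T ^^ n) x) ((T ^^ n) x)) \<longlonglongrightarrow> 0"
  shows "zero_Cauchy X p (\<lambda>n. (T ^^ n) x)"
proof -
  let ?x = "\<lambda>n. (T ^^ n) x"
  let ?g = "\<lambda>n. p (?x (Suc n)) (?x (Suc n)) + p (?x n) (?x (Suc n))"
  have X: "?x m \<in> X" for m using x by (rule funpow_in)
  have g: "?g \<longlonglongrightarrow> 0"
    using tendsto_add[OF LIMSEQ_Suc[OF self] orbit_steps_tendsto_0[OF x self]] by simp
  have "((\<lambda>(n, m). p (?x n) (?x m)) \<longlongrightarrow> 0) (sequentially \<times>\<^sub>F sequentially)"
  proof (rule tendstoI)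
    fix e :: real
    assume "0 < e"
    then obtain N where N: "\<And>n. n \<ge> N \<Longrightarrow> norm (?g n - 0) < e"
      using LIMSEQ_D[OF g] by blast
    have ordered: "p (?x m) (?x n) < e" if "Suc N \<le> n" "n \<le> m" for n m
    proof -
      obtain i where i: "n = Suc i" "N \<le> i" using \<open>Suc N \<le> n\<close> by (cases n) auto
      have "m = Suc i + (m - n)" using i \<open>n \<le> m\<close> by simp
      then have "p (?x m) (?x n) \<le> ?g i"
        using orbit_distance_bound[OF x, of i "m - n"] i by metis
      also have "\<dots> < e" using N[OF i(2)] by simp
      finally show ?thesis .
    qed
    have "dist (p (?x n) (?x m)) 0 < e" if "Suc N \<le> n" "Suc N \<le> m" for n m
      using ordered[of n m] ordered[of m n] that p_sym[OF X X, of n m] p_nonneg[OF X X, of n m]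
      by (cases "n \<le> m") auto
    then show "\<forall>\<^sub>F z in sequentially \<times>\<^sub>F sequentially.
        dist (case z of (n, m) \<Rightarrow> p (?x n) (?x m)) 0 < e"
      unfolding eventually_prod_sequentially by auto
  qed
  with X show ?thesis by (auto simp: zero_Cauchy_def)
qed

section \<open>Fixed points\<close>

text \<open>
  The points \<open>T (s n)\<close> are close both to \<open>u\<close> and, by the contraction condition, to \<open>T u\<close>; the
  triangle inequality compares these two limits with the constant factor \<open>\<theta> (T u) u\<close>.
\<close>

lemma limit_is_fixed_point:
  assumes u: "u \<in> X" and s: "\<And>n. s n \<in> X"
    and steps: "(\<lambda>n. p (s n) (T (s n))) \<longlonglongrightarrow> 0"
    and lim: "(\<lambda>n. p (T (s n)) u) \<longlonglongrightarrow> 0"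
  shows "T u = u"
proof (rule zero_distance_imp_eq)
  show Tu: "T u \<in> X" using u by (rule T_in)
  let ?h = "\<lambda>n. \<theta> (T u) u * (k * (p (T (s n)) u + p (s n) (T (s n))) + p (T (s n)) u)"
  have "?h \<longlonglongrightarrow> \<theta> (T u) u * (k * (0 + 0) + 0)"
    by (intro tendsto_intros steps lim)
  then have h: "?h \<longlonglongrightarrow> 0" by simp
  have "p (T u) u \<le> ?h n" for n
  proof -
    have Ts: "T (s n) \<in> X" using s by (rule T_in)
    have "p (T u) u \<le> \<theta> (T u) u * (p (T u) (T (s n)) + p (T (s n)) u)"
      using p_triangle[OF Tu Ts u] p_nonneg[OF Ts Ts] by linarith
    also have "\<dots> \<le> ?h n"
      using contraction[OF u s[of n]] theta_ge_1[OF Tu u] p_sym[OF u Ts]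
      by (intro mult_left_mono) auto
    finally show ?thesis .
  qed
  then have "p (T u) u \<le> 0"
    by (intro LIMSEQ_le_const[OF h]) auto
  then show "p (T u) u = 0" using p_nonneg[OF Tu u] by simp
qed fact

lemma fixed_points_eq:
  assumes u: "u \<in> X" "T u = u" and v: "v \<in> X" "T v = v"
  shows "u = v"
proof (rule zero_distance_imp_eq)
  have "p u v \<le> k * (p u v + p v v)"
    using contraction[OF u(1) v(1)] u(2) v(2) by simp
  also have "\<dots> \<le> k * (p u v + p u v)"
    using p_self_le[OF v(1) u(1)] p_sym[OF u(1) v(1)] k_nonneg by (intro mult_left_mono) auto
  finally have "(1 - 2 * k) * p u v \<le> 0" by (simp add: algebra_simps)
  then have "p u v \<le> 0" using k_less_half by (simp add: mult_le_0_iff)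
  then show "p u v = 0" using p_nonneg[OF u(1) v(1)] by simp
qed fact+

end

theorem theorem3p12:
  fixes X :: "'a set"
    and p \<theta> :: "'a \<Rightarrow> 'a \<Rightarrow> real"
    and k :: real
    and T :: "'a \<Rightarrow> 'a"
    and x0 :: 'a
  assumes "partial_extended_b_metric_space X p \<theta>"
    and "zero_complete X p"
    and "0 \<le> k" and "k < 1 / 2"
    and "T \<in> X \<rightarrow> X"
    and "\<And>x. x \<in> X \<Longrightarrow> ereal (\<theta> (T x) x) < 1 / ereal k"
    and "\<And>x y. x \<in> X \<Longrightarrow> y \<in> X \<Longrightarrow> p (T x) (T y) \<le> k * (p x (T y) + p y (T y))"
    and "x0 \<in> X"
    and "(\<lambda>n. real n * p ((T ^^ n) x0) ((T ^^ n) x0)) \<longlonglongrightarrow> 0"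
  shows "\<exists>u. (u \<in> X \<and> T u = u) \<and> (\<forall>v. v \<in> X \<and> T v = v \<longrightarrow> v = u) \<and>
             converges_to X p (\<lambda>n. (T ^^ n) x0) u \<and> p u u = 0"
proof -
  interpret partial_extended_b_metric_space X p \<theta> by fact
  interpret one_sided_contraction X p \<theta> k T
    using assms(3,4,5,7) by unfold_locales (auto simp: Pi_iff)
  let ?x = "\<lambda>n. (T ^^ n) x0"
  have X: "?x n \<in> X" for n using \<open>x0 \<in> X\<close> by (rule funpow_in)
  have self: "(\<lambda>n. p (?x n) (?x n)) \<longlonglongrightarrow> 0"
    using assms(9) by (rule tendsto_0_if_mult_real_of_nat_tendsto_0)
  obtain u where u: "u \<in> X" and lim: "(\<lambda>n. p (?x n) u) \<longlonglongrightarrow> 0" and uu: "p u u = 0"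
    using \<open>zero_complete X p\<close> orbit_zero_Cauchy[OF \<open>x0 \<in> X\<close> self]
    unfolding zero_complete_def by blast
  have fixed: "T u = u"
  proof (rule limit_is_fixed_point[OF u X])
    show "(\<lambda>n. p (?x n) (T (?x n))) \<longlonglongrightarrow> 0"
      using orbit_steps_tendsto_0[OF \<open>x0 \<in> X\<close> self] by simp
    show "(\<lambda>n. p (T (?x n)) u) \<longlonglongrightarrow> 0"
      using LIMSEQ_Suc[OF lim] by simp
  qed
  have "converges_to X p ?x u"
    using X u lim uu by (auto simp: converges_to_def)
  with u uu fixed show ?thesis
    using fixed_points_eq by blast
qed

end
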